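(* Let $\gamma:[0,L]\to\mathbb{R}^2$ be a smooth curve parametrized by arc length whose $\infty$-jets at $t=0$ and $t=L$ coincide with the $\infty$-jets of the $x$-axis (oriented to the right) at the points $(0,0)$ and $(1,0)$, respectively. Let $\Gamma=T(\gamma)=\gamma+\gamma'$. Assume that $E(\gamma)$ is finite. Then $E(\Gamma)>E(\gamma)$.
   Context: The condition on $\infty$-jets means: $\gamma(0)=(0,0)$, $\gamma(L)=(1,0)$, $\gamma'(0)=\gamma'(L)=(1,0)$, and all derivatives of $\gamma$ of order $\ge2$ vanish at $t=0$ and $t=L$. The curve $\Gamma(t)=\gamma(t)+\gamma'(t)$, $t\in[0,L]$, is the locus of endpoints of the unit tangent segments to $\gamma$ (the front wheel track of a bicycle of length $1$ with rear wheel track $\gamma$); it is a smooth curve tangent to the $x$-axis to all orders at its endpoints $(1,0)$ and $(2,0)$. For such a curve, $E$ denotes the number of its locally highest and locally lowest points, i.e. the number of parameter values $t\in(0,L)$ (end points excluded) at which the height ($y$-coordinate) has a local maximum or a local minimum (a value of $+\infty$ is regarded as greater than any finite value). *)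

theory Defs
  imports "HOL-Analysis.Analysis" "HOL-Library.Extended_Nat"
begin

text \<open>Derivatives are taken within \<open>S\<close>, so for \<open>S = {0..L}\<close> they are one-sided
  at the end points.\<close>

primrec nth_deriv_within ::
    "nat \<Rightarrow> real set \<Rightarrow> (real \<Rightarrow> 'a::real_normed_vector) \<Rightarrow> real \<Rightarrow> 'a" where
  "nth_deriv_within 0 S c = c"
| "nth_deriv_within (Suc n) S c =
     (\<lambda>t. vector_derivative (nth_deriv_within n S c) (at t within S))"

definition smooth_curve_on :: "real set \<Rightarrow> (real \<Rightarrow> 'a::real_normed_vector) \<Rightarrow> bool" where
  "smooth_curve_on S c \<longleftrightarrow>
     (\<forall>n. \<forall>t\<in>S. nth_deriv_within n S c differentiable (at t within S))"

definition arc_length_param_on :: "real set \<Rightarrow> (real \<Rightarrow> 'a::real_normed_vector) \<Rightarrow> bool" where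
  "arc_length_param_on S c \<longleftrightarrow> (\<forall>t\<in>S. norm (vector_derivative c (at t within S)) = 1)"

text \<open>The \<open>\<infinity>\<close>-jet of \<open>c\<close> at \<open>t\<close> is that of the \<open>x\<close>-axis, parametrized by arc length and
  oriented to the right, at the point \<open>p\<close>.\<close>

definition has_x_axis_jet_at ::
    "(real \<Rightarrow> real \<times> real) \<Rightarrow> real set \<Rightarrow> real \<Rightarrow> real \<times> real \<Rightarrow> bool" where
  "has_x_axis_jet_at c S t p \<longleftrightarrow>
     c t = p \<and> nth_deriv_within 1 S c t = (1, 0) \<and>
     (\<forall>n\<ge>2. nth_deriv_within n S c t = (0, 0))"

definition front_track :: "real \<Rightarrow> (real \<Rightarrow> real \<times> real) \<Rightarrow> real \<Rightarrow> real \<times> real" where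
  "front_track L c = (\<lambda>t. c t + vector_derivative c (at t within {0..L}))"

text \<open>Local extrema are not required to be strict: on an interval of constant height every
  parameter value counts, so for instance a horizontal segment has infinitely many.\<close>

definition height_extrema :: "real \<Rightarrow> (real \<Rightarrow> real \<times> real) \<Rightarrow> real set" where
  "height_extrema L c =
     {t \<in> {0<..<L}.
        (\<forall>\<^sub>F s in at t within {0..L}. snd (c s) \<le> snd (c t)) \<or>
        (\<forall>\<^sub>F s in at t within {0..L}. snd (c t) \<le> snd (c s))}"

definition num_extrema :: "real \<Rightarrow> (real \<Rightarrow> real \<times> real) \<Rightarrow> enat" where
  "num_extrema L c =
     (if finite (height_extrema L c) then enat (card (height_extrema L c)) else \<infinity>)"

end

theory Submission
  imports Defs
begin

text \<open>Write \<open>y\<close> for the height of \<open>\<gamma>\<close>, so that \<open>Y = y + y'\<close> is the height of \<open>\<Gamma>\<close> and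
  \<open>e\<^sup>t Y' = (e\<^sup>t y')'\<close>. The \<open>E(\<gamma>)\<close> extrema of \<open>y\<close> cut \<open>[0,L]\<close> into \<open>E(\<gamma>) + 1\<close> intervals. The
  function \<open>e\<^sup>t y'\<close> vanishes at both ends of each of them, but not identically on it, because
  otherwise \<open>y\<close> would be constant there and would have further extrema. Hence \<open>Y'\<close> takes both
  signs on each interval, and \<open>Y\<close> has a local extremum inside each.\<close>

text \<open>As in the proof of Darboux's theorem: continuity gives a maximum on the compact
  interval, and the signs of \<open>g'\<close> at the two ends keep it away from them.\<close>

lemma interior_max_of_deriv_signs:
  fixes g g' :: "real \<Rightarrow> real"
  assumes "a < b"
    and der: "\<And>x. x \<in> {a..b} \<Longrightarrow> (g has_real_derivative g' x) (at x)"
    and "g' a > 0" "g' b < 0"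
  obtains t where "a < t" "t < b" "\<forall>s\<in>{a..b}. g s \<le> g t"
proof -
  have "continuous_on {a..b} g"
    by (meson DERIV_continuous_on der has_field_derivative_at_within)
  then obtain t where t: "t \<in> {a..b}" "\<forall>s\<in>{a..b}. g s \<le> g t"
    using continuous_attains_sup[of "{a..b}" g] \<open>a < b\<close> by auto
  have "t \<noteq> a"
  proof
    assume "t = a"
    obtain d where d: "d > 0" "\<forall>h>0. h < d \<longrightarrow> g a < g (a + h)"
      using DERIV_pos_inc_right[OF der[of a] \<open>g' a > 0\<close>] \<open>a < b\<close> by auto
    \<comment> \<open>Halving \<open>d\<close> keeps \<open>h\<close> strictly below it, and the cap
      \<open>b - a\<close> keeps \<open>a + h\<close> in the interval.\<close>
    define h where "h = min (d/2) (b - a)"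
    have "h > 0" "h < d" "a + h \<in> {a..b}"
      using d \<open>a < b\<close> by (auto simp: h_def min_def)
    then show False using d(2) t(2) \<open>t = a\<close> by (meson not_le)
  qed
  moreover have "t \<noteq> b"
  proof
    assume "t = b"
    obtain d where d: "d > 0" "\<forall>h>0. h < d \<longrightarrow> g b < g (b - h)"
      using DERIV_neg_dec_left[OF der[of b] \<open>g' b < 0\<close>] \<open>a < b\<close> by auto
    define h where "h = min (d/2) (b - a)"
    have "h > 0" "h < d" "b - h \<in> {a..b}"
      using d \<open>a < b\<close> by (auto simp: h_def min_def)
    then show False using d(2) t(2) \<open>t = b\<close> by (meson not_le)
  qed
  ultimately show ?thesis using that t by force
qed

lemma interior_extremum_of_deriv_signs:
  fixes g g' :: "real \<Rightarrow> real"
  assumes "a < b"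
    and der: "\<And>x. x \<in> {a..b} \<Longrightarrow> (g has_real_derivative g' x) (at x)"
    and sgn: "g' a * g' b < 0"
  obtains t where "a < t" "t < b"
    "(\<forall>s\<in>{a..b}. g s \<le> g t) \<or> (\<forall>s\<in>{a..b}. g t \<le> g s)"
proof -
  consider "g' a > 0" "g' b < 0" | "- g' a > 0" "- g' b < 0"
    using sgn by (auto simp: mult_less_0_iff)
  then show ?thesis
  proof cases
    case 1
    then show ?thesis
      using interior_max_of_deriv_signs[OF \<open>a < b\<close> der] that by blast
  next
    case 2
    \<comment> \<open>Reflection reduces this sign pattern to the first one; a maximum of
      \<open>- g\<close> is a minimum of \<open>g\<close>.\<close>
    have "((\<lambda>x. - g x) has_real_derivative - g' x) (at x)" if "x \<in> {a..b}" for x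
      using der[OF that] by (rule DERIV_minus)
    then obtain t where "a < t" "t < b" "\<forall>s\<in>{a..b}. - g s \<le> - g t"
      using interior_max_of_deriv_signs[OF \<open>a < b\<close> _ 2] by blast
    then show ?thesis using that by auto
  qed
qed

text \<open>\<open>S\<close> cuts the interval into \<open>card S + 1\<close> disjoint gaps, indexed
  by their left ends in \<open>insert a S\<close>. Choosing a point of \<open>T\<close> in each gap
  is therefore injective.\<close>

lemma card_less_of_meets_gaps:
  fixes S T :: "'a::linorder set"
  assumes "finite S" "finite T" "S \<subseteq> {a<..<b}" "a < b"
    and gap: "\<And>u v. u \<in> insert a S \<Longrightarrow> v \<in> insert b S \<Longrightarrow> u < v \<Longrightarrow> {u<..<v} \<inter> S = {}
                \<Longrightarrow> {u<..<v} \<inter> T \<noteq> {}"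
  shows "card S < card T"
proof -
  \<comment> \<open>The right end of the gap that starts at \<open>u\<close>; the point
    \<open>b\<close> makes the set nonempty.\<close>
  define nxt where "nxt u = Min {v \<in> insert b S. u < v}" for u
  have nxt: "nxt u \<in> insert b S" "u < nxt u" "\<And>v. v \<in> S \<Longrightarrow> u < v \<Longrightarrow> nxt u \<le> v"
    if "u \<in> insert a S" for u
  proof -
    have "b \<in> {v \<in> insert b S. u < v}" using that assms by auto
    then have "nxt u \<in> {v \<in> insert b S. u < v}"
      unfolding nxt_def using \<open>finite S\<close> by (intro Min_in) auto
    then show "nxt u \<in> insert b S" "u < nxt u" by auto
    show "nxt u \<le> v" if "v \<in> S" "u < v" for v
      unfolding nxt_def using \<open>finite S\<close> that by (intro Min_le) auto
  qed
  have "\<exists>t. t \<in> T \<and> u < t \<and> t < nxt u" if "u \<in> insert a S" for u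
  proof -
    have "{u<..<nxt u} \<inter> S = {}" using nxt(3)[OF that] by force
    then show ?thesis using gap[OF that nxt(1,2)[OF that]] by auto
  qed
  then obtain g where g: "\<And>u. u \<in> insert a S \<Longrightarrow> g u \<in> T \<and> u < g u \<and> g u < nxt u"
    by metis
  \<comment> \<open>The chain is \<open>g u < nxt u \<le> v < g v\<close>.\<close>
  have mono: "g u < g v" if "u \<in> insert a S" "v \<in> insert a S" "u < v" for u v
  proof -
    have "v \<in> S" using that assms by force
    then show ?thesis using nxt(3)[of u v] g[of u] g[of v] that by force
  qed
  then have "inj_on g (insert a S)"
    by (metis inj_onI less_irrefl linorder_neqE)
  then have "card (insert a S) \<le> card T"
    using g \<open>finite T\<close> by (intro card_inj_on_le) auto
  \<comment> \<open>The left end \<open>a\<close> is the additional index that makes the inequality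
    strict.\<close>
  moreover have "a \<notin> S" using assms by auto
  ultimately show ?thesis using \<open>finite S\<close> by simp
qed

lemma smooth_curve_on_has_vector_derivative:
  assumes "smooth_curve_on S c" "t \<in> S"
  shows "(nth_deriv_within n S c has_vector_derivative nth_deriv_within (Suc n) S c t)
           (at t within S)"
  using assms unfolding smooth_curve_on_def by (simp add: vector_derivative_works)

text \<open>With the integrating factor, \<open>exp t * y1 t\<close> has derivative
  \<open>exp t * (y1 t + y2 t)\<close>. It vanishes at \<open>u\<close> and \<open>v\<close> but not
  at \<open>p\<close>, so the mean value theorem on either side of \<open>p\<close> yields points
  \<open>a < p < b\<close> where this derivative has opposite signs. As \<open>a\<close> and
  \<open>b\<close> are strictly inside, \<open>y + y1\<close> is differentiable on all of
  \<open>{a..b}\<close>.\<close>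

lemma extremum_add_deriv_between_zeros:
  fixes y y1 y2 :: "real \<Rightarrow> real"
  assumes "u < v"
    and cont: "continuous_on {u..v} y1"
    and y: "\<And>t. u < t \<Longrightarrow> t < v \<Longrightarrow> (y has_real_derivative y1 t) (at t)"
    and y1: "\<And>t. u < t \<Longrightarrow> t < v \<Longrightarrow> (y1 has_real_derivative y2 t) (at t)"
    and zero: "y1 u = 0" "y1 v = 0" and p: "u < p" "p < v" "y1 p \<noteq> 0"
  obtains a b t where "u < a" "a < t" "t < b" "b < v"
    "(\<forall>s\<in>{a..b}. y s + y1 s \<le> y t + y1 t) \<or> (\<forall>s\<in>{a..b}. y t + y1 t \<le> y s + y1 s)"
proof -
  define f where "f t = exp t * y1 t" for t
  have contf: "continuous_on {u..v} f"
    unfolding f_def by (intro continuous_intros cont)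
  have f: "(f has_real_derivative exp t * (y1 t + y2 t)) (at t)" if "u < t" "t < v" for t
    unfolding f_def using y1[OF that]
    by (auto intro!: derivative_eq_intros simp: algebra_simps)
  have diff: "f differentiable (at t)" if "u < t" "t < v" for t
    using f[OF that] real_differentiable_def by blast
  obtain l a where a: "u < a" "a < p" "DERIV f a :> l" "f p - f u = (p - u) * l"
    using MVT[of u p f] p continuous_on_subset[OF contf, of "{u..p}"] diff by auto
  obtain m b where b: "p < b" "b < v" "DERIV f b :> m" "f v - f p = (v - p) * m"
    using MVT[of p v f] p continuous_on_subset[OF contf, of "{p..v}"] diff by auto
  have l: "l = exp a * (y1 a + y2 a)" using DERIV_unique[OF a(3) f] a p by auto
  have m: "m = exp b * (y1 b + y2 b)" using DERIV_unique[OF b(3) f] b p by auto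
  have "f u = 0" "f v = 0" "f p \<noteq> 0"
    using p zero by (auto simp: f_def)
  then have "l = f p / (p - u)" "m = - (f p / (v - p))"
    using a(4) b(4) p by (auto simp: field_simps)
  then have "l * m < 0" using p \<open>f p \<noteq> 0\<close>
    by (auto simp: mult_less_0_iff divide_less_0_iff zero_less_divide_iff zero_less_mult_iff)
  \<comment> \<open>The positive factors \<open>exp a\<close> and \<open>exp b\<close> do not affect
    the sign.\<close>
  then have sgn: "(y1 a + y2 a) * (y1 b + y2 b) < 0"
    unfolding l m by (simp add: mult_less_0_iff zero_less_mult_iff)
  have "((\<lambda>t. y t + y1 t) has_real_derivative y1 x + y2 x) (at x)" if "x \<in> {a..b}" for x
    using y[of x] y1[of x] that a b by (intro DERIV_add) auto
  then obtain t where "a < t" "t < b"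
    "(\<forall>s\<in>{a..b}. y s + y1 s \<le> y t + y1 t) \<or> (\<forall>s\<in>{a..b}. y t + y1 t \<le> y s + y1 s)"
    using interior_extremum_of_deriv_signs[of a b "\<lambda>t. y t + y1 t" "\<lambda>t. y1 t + y2 t"] sgn a b
    by auto
  then show ?thesis using that a b by blast
qed

text \<open>The strict inequalities around \<open>t\<close> make \<open>{a..b}\<close> a
  neighbourhood of \<open>t\<close>, so an extremum over it is a local one.\<close>

lemma height_extremaI:
  assumes "0 \<le> a" "a < t" "t < b" "b \<le> L"
    and ext: "(\<forall>s\<in>{a..b}. snd (c s) \<le> snd (c t)) \<or> (\<forall>s\<in>{a..b}. snd (c t) \<le> snd (c s))"
  shows "t \<in> height_extrema L c"
proof -
  have "\<forall>\<^sub>F s in at t within {0..L}. s \<in> {a<..<b}"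
    using filter_leD[OF at_le[OF subset_UNIV] eventually_at_in_open'[of "{a<..<b}" t]] assms
    by auto
  then have ev: "\<forall>\<^sub>F s in at t within {0..L}. P s" if "\<forall>s\<in>{a..b}. P s" for P
    by (rule eventually_mono) (use that in auto)
  show ?thesis
    using assms ext ev[of "\<lambda>s. snd (c s) \<le> snd (c t)"] ev[of "\<lambda>s. snd (c t) \<le> snd (c s)"]
    by (auto simp: height_extrema_def)
qed

text \<open>Fermat's criterion; it applies because \<open>t\<close> is interior, where the filter
  within \<open>{0..L}\<close> is the two-sided one.\<close>

lemma height_extrema_deriv_zero:
  assumes "t \<in> height_extrema L c"
    and der: "((\<lambda>s. snd (c s)) has_real_derivative D) (at t)"
  shows "D = 0"
proof -
  have t: "0 < t" "t < L" using assms by (auto simp: height_extrema_def)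
  then have "at t within {0..L} = at t" by (simp add: at_within_Icc_at)
  then have "(\<forall>\<^sub>F s in at t. snd (c s) \<le> snd (c t)) \<or> (\<forall>\<^sub>F s in at t. snd (c t) \<le> snd (c s))"
    using assms by (simp add: height_extrema_def)
  then obtain d where "d > 0" and d:
      "(\<forall>s. s \<noteq> t \<and> dist s t < d \<longrightarrow> snd (c s) \<le> snd (c t)) \<or>
       (\<forall>s. s \<noteq> t \<and> dist s t < d \<longrightarrow> snd (c t) \<le> snd (c s))"
    unfolding eventually_at by fast
  \<comment> \<open>The punctured neighbourhood is filled in: at \<open>s = t\<close> both
    inequalities are trivial.\<close>
  then have "(\<forall>s. \<bar>t - s\<bar> < d \<longrightarrow> snd (c s) \<le> snd (c t)) \<or>
       (\<forall>s. \<bar>t - s\<bar> < d \<longrightarrow> snd (c t) \<le> snd (c s))"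
    by (metis abs_minus_commute dist_real_def order_refl)
  then show ?thesis
    using DERIV_local_max[OF der \<open>d > 0\<close>] DERIV_local_min[OF der \<open>d > 0\<close>] by auto
qed

theorem proposition5p4:
  fixes L :: real and \<gamma> :: "real \<Rightarrow> real \<times> real"
  assumes "0 < L"
    and "smooth_curve_on {0..L} \<gamma>"
    and "arc_length_param_on {0..L} \<gamma>"
    and "has_x_axis_jet_at \<gamma> {0..L} 0 (0, 0)"
    and "has_x_axis_jet_at \<gamma> {0..L} L (1, 0)"
    and "num_extrema L \<gamma> < \<infinity>"
  shows "num_extrema L (front_track L \<gamma>) > num_extrema L \<gamma>"
proof -
  define S where "S = height_extrema L \<gamma>"
  define T where "T = height_extrema L (front_track L \<gamma>)"
  define y where "y n t = snd (nth_deriv_within n {0..L} \<gamma> t)" for n t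
  have der_within: "(y n has_real_derivative y (Suc n) t) (at t within {0..L})"
    if "t \<in> {0..L}" for n t
    using bounded_linear.has_vector_derivative[OF bounded_linear_snd
        smooth_curve_on_has_vector_derivative[OF assms(2) that, of n]]
    unfolding has_real_derivative_iff_has_vector_derivative y_def .
  have der: "(y n has_real_derivative y (Suc n) t) (at t)" if "0 < t" "t < L" for n t
    using der_within[of t n] that by (simp add: at_within_Icc_at)
  have cont: "continuous_on {0..L} (y n)" for n
    using der_within by (rule DERIV_continuous_on)
  have y0: "snd (\<gamma> t) = y 0 t" for t by (simp add: y_def)
  have front: "snd (front_track L \<gamma> t) = y 0 t + y 1 t" for t
    by (simp add: y_def front_track_def)
  have finS: "finite S"
    using assms(6) by (auto simp: num_extrema_def S_def split: if_splits)
  have Ssub: "S \<subseteq> {0<..<L}" by (auto simp: S_def height_extrema_def)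
  \<comment> \<open>At the end points this comes from the prescribed jets, on \<open>S\<close> from
    Fermat's criterion.\<close>
  have zero: "y 1 t = 0" if "t \<in> insert 0 (insert L S)" for t
  proof -
    have "y 1 0 = 0" "y 1 L = 0"
      using assms(4,5) by (auto simp: has_x_axis_jet_at_def y_def)
    moreover have "y 1 t = 0" if "t \<in> S"
      using height_extrema_deriv_zero[of t L \<gamma>] der[of t 0] that Ssub
      by (auto simp: S_def y0)
    ultimately show ?thesis using that by auto
  qed
  have gap: "{u<..<v} \<inter> T \<noteq> {}"
    if uv: "u \<in> insert 0 S" "v \<in> insert L S" "u < v" and empty: "{u<..<v} \<inter> S = {}" for u v
  proof -
    have bounds: "0 \<le> u" "v \<le> L" using uv Ssub \<open>0 < L\<close> by auto
    \<comment> \<open>Otherwise \<open>y 0\<close> would be constant on \<open>{u..v}\<close>.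
      Extrema need not be strict, so every point inside would belong to \<open>S\<close>, against
      the choice of a gap.\<close>
    have "\<exists>p. u < p \<and> p < v \<and> y 1 p \<noteq> 0"
    proof (rule ccontr)
      assume "\<not> ?thesis"
      then have "(y 0 has_real_derivative 0) (at t)" if "u < t" "t < v" for t
        using der[of t 0] that bounds by force
      moreover have "continuous_on {u..v} (y 0)"
        using cont bounds by (rule_tac continuous_on_subset) auto
      ultimately have const: "y 0 s = y 0 u" if "u \<le> s" "s \<le> v" for s
        using DERIV_isconst2[OF \<open>u < v\<close>] that by blast
      obtain m where m: "u < m" "m < v" using dense[OF \<open>u < v\<close>] by blast
      then have "\<forall>s\<in>{u..v}. snd (\<gamma> s) \<le> snd (\<gamma> m)"
        unfolding y0 by (metis const atLeastAtMost_iff less_imp_le order_refl)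
      then have "m \<in> S"
        unfolding S_def using m bounds by (intro height_extremaI[of u _ v]) auto
      then show False using empty m by auto
    qed
    then obtain p where p: "u < p" "p < v" "y 1 p \<noteq> 0" by blast
    obtain a b t where t: "u < a" "a < t" "t < b" "b < v"
      "(\<forall>s\<in>{a..b}. y 0 s + y 1 s \<le> y 0 t + y 1 t) \<or>
       (\<forall>s\<in>{a..b}. y 0 t + y 1 t \<le> y 0 s + y 1 s)"
    proof (rule extremum_add_deriv_between_zeros[of u v "y 1" "y 0" "y 2" p])
      show "continuous_on {u..v} (y 1)"
        using cont by (rule continuous_on_subset) (use bounds in auto)
      show "(y 0 has_real_derivative y 1 t) (at t)" if "u < t" "t < v" for t
        using der[of t 0] that bounds by simp
      show "(y 1 has_real_derivative y 2 t) (at t)" if "u < t" "t < v" for t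
        using der[of t 1] that bounds by (simp add: numeral_2_eq_2)
    qed (use p zero uv in auto)
    \<comment> \<open>By \<open>front\<close>, the function \<open>y 0 + y 1\<close> is the height
      of the front track.\<close>
    have "t \<in> T"
      unfolding T_def
      by (rule height_extremaI[of a _ b]) (use t bounds in \<open>auto simp: front\<close>)
    moreover have "t \<in> {u<..<v}" using t by simp
    ultimately show ?thesis by blast
  qed
  show ?thesis
  proof (cases "finite T")
    case True
    have "card S < card T"
      using card_less_of_meets_gaps[OF finS True Ssub \<open>0 < L\<close> gap] .
    then show ?thesis
      using finS True by (simp add: num_extrema_def S_def T_def)
  next
    \<comment> \<open>Here the front track has the value \<open>\<infinity>\<close>, which exceeds
      the finite count for \<open>\<gamma>\<close>.\<close>
    case False
    then show ?thesis
      using assms(6) by (simp add: num_extrema_def T_def)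
  qed
qed

end
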